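(* Let $G$ be a connected graph of order at least $3$. Then $G$ has a partial $3$-coloring with colors from $\{1,2,3\}$ such that for every vertex $v$ of $G$ (colored or not) and every color $i\in\{1,2,3\}$, there is a vertex of color $i$ at distance at most $3$ from $v$.
   Context: All graphs are finite and simple. A partial coloring of $G$ is an assignment of colors to a subset of the vertices of $G$ such that any two adjacent colored vertices receive different colors (uncolored vertices impose no constraint). Distance is the usual shortest-path distance in $G$ (a vertex is at distance $0$ from itself). *)

theory Defs
  imports "Graph_Theory.Graph_Theory"
begin

text \<open>
  Finite simple graphs are the locale \<^locale>\<open>graph\<close> of Graph_Theory: finite loopfree symmetric
  digraphs without parallel arcs, each edge being a pair of opposite arcs.
\<close>

text \<open>Infimum of the lengths of all walks from \<open>u\<close> to \<open>v\<close>, infinite if there is none.\<close>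

definition graph_dist :: "('a, 'b) pre_digraph \<Rightarrow> 'a \<Rightarrow> 'a \<Rightarrow> ereal" where
  "graph_dist G u v = wf_digraph.\<mu> G (\<lambda>_. 1) u v"

definition partial_coloring ::
    "('a, 'b) pre_digraph \<Rightarrow> nat set \<Rightarrow> ('a \<Rightarrow> nat option) \<Rightarrow> bool" where
  "partial_coloring G C f \<longleftrightarrow>
     dom f \<subseteq> verts G \<and> ran f \<subseteq> C \<and>
     (\<forall>u \<in> dom f. \<forall>v \<in> dom f. u \<rightarrow>\<^bsub>G\<^esub> v \<longrightarrow> f u \<noteq> f v)"

lemma (in wf_digraph) graph_dist_le_iff:
  "graph_dist G u v \<le> ereal (real n) \<longleftrightarrow> (\<exists>p. awalk u p v \<and> length p \<le> n)"
proof
  have cost: "awalk_cost (\<lambda>_. 1) p = real (length p)" for p :: "'b list"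
    by (induction p) auto
  show "graph_dist G u v \<le> ereal (real n)" if "\<exists>p. awalk u p v \<and> length p \<le> n"
    using that min_cost_le_walk_cost[where c = "\<lambda>_. 1"]
    by (force simp: graph_dist_def cost intro: order_trans)
  show "\<exists>p. awalk u p v \<and> length p \<le> n" if le: "graph_dist G u v \<le> ereal (real n)"
  proof -
    have "graph_dist G u v < ereal (real n + 1)"
      using le by (rule order_le_less_trans) simp
    then obtain p where "awalk u p v" "ereal (real (length p)) < ereal (real n + 1)"
      by (auto simp: graph_dist_def \<mu>_def Inf_less_iff cost)
    then show ?thesis by (intro exI[of _ p]) auto
  qed
qed

end

theory Submission
  imports Defs
begin

text \<open>
  Root the graph at a vertex that is not adjacent to all others, let \<open>d\<close> be the distance from the
  root, and let \<open>I\<close> be a maximal independent set of the graph formed by the edges inside the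
  distance layers. Colour each \<open>v \<in> I\<close> by \<open>d v mod 3\<close>; adjacent vertices lie in equal or consecutive
  layers, so this is proper. Every vertex has a vertex of \<open>I\<close> of its own layer within distance 1,
  so a vertex in layer at least 2 reaches all colours through itself, its parent and its grandparent.
  Vertices in layers 0 and 1 reach the missing colour by going through the root to a vertex of \<open>I\<close>
  in layer 2. If there is no suitable root, the graph is complete and three vertices suffice.
\<close>

text \<open>Greedy insertion: a new element joins \<open>I\<close> exactly when it has no neighbour
  there. The relation \<open>E\<close> is kept abstract so that it can later be adjacency inside a
  layer.\<close>

lemma finite_maximal_independent:
  assumes "finite A" and "\<And>x y. E x y \<Longrightarrow> E y x" and "\<And>x. \<not> E x x"
  obtains I where "I \<subseteq> A" "\<And>x y. x \<in> I \<Longrightarrow> y \<in> I \<Longrightarrow> \<not> E x y"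
    "\<And>x. x \<in> A \<Longrightarrow> x \<in> I \<or> (\<exists>y\<in>I. E x y)"
  using assms(1)
proof (induction A arbitrary: thesis rule: finite_induct)
  case empty
  show ?case by (rule empty(1)[of "{}"]) auto
next
  case (insert a A)
  obtain I where I: "I \<subseteq> A" "\<And>x y. x \<in> I \<Longrightarrow> y \<in> I \<Longrightarrow> \<not> E x y"
    "\<And>x. x \<in> A \<Longrightarrow> x \<in> I \<or> (\<exists>y\<in>I. E x y)"
    using insert.IH by blast
  show ?case
  proof (cases "\<exists>y\<in>I. E a y")
    case True
    then show ?thesis by (intro insert.prems[of I]) (use I in auto)
  next
    case False
    then show ?thesis by (intro insert.prems[of "insert a I"]) (use I assms(2,3) in blast)+
  qed
qed

text \<open>Natural-number form of \<open>graph_dist G u v \<le> n\<close>, by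
  \<open>graph_dist_le_iff\<close>; it keeps \<open>ereal\<close> out of the layer
  arguments.\<close>

definition dist_le :: "('a, 'b) pre_digraph \<Rightarrow> nat \<Rightarrow> 'a \<Rightarrow> 'a \<Rightarrow> bool" where
  "dist_le G n u v \<longleftrightarrow> (\<exists>p. pre_digraph.awalk G u p v \<and> length p \<le> n)"

text \<open>The \<open>LEAST\<close> is attained only if some walk from \<open>r\<close> to
  \<open>v\<close> exists; \<open>dist_le_depth\<close> obtains one from connectedness.\<close>

definition depth :: "('a, 'b) pre_digraph \<Rightarrow> 'a \<Rightarrow> 'a \<Rightarrow> nat" where
  "depth G r v = (LEAST n. dist_le G n r v)"

context wf_digraph
begin

lemma dist_le_refl: "v \<in> verts G \<Longrightarrow> dist_le G n v v"
  unfolding dist_le_def by (intro exI[of _ "[]"]) (simp add: awalk_Nil_iff)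

lemma dist_le_arc: "u \<rightarrow>\<^bsub>G\<^esub> v \<Longrightarrow> dist_le G 1 u v"
  unfolding dist_le_def arcs_ends_def arc_to_ends_def
  by (force intro: exI[of _ "[_]"] arc_implies_awalk)

lemma dist_le_trans: "dist_le G m u v \<Longrightarrow> dist_le G n v w \<Longrightarrow> dist_le G (m + n) u w"
  unfolding dist_le_def by (metis add_mono awalk_appendI length_append)

lemma dist_le_mono: "dist_le G m u v \<Longrightarrow> m \<le> n \<Longrightarrow> dist_le G n u v"
  unfolding dist_le_def using order_trans by blast

text \<open>A witnessing walk must have length exactly \<open>Suc n\<close>, so dropping its last
  arc leaves a walk of length \<open>n\<close>.\<close>

lemma dist_le_SucD:
  assumes "dist_le G (Suc n) u v" "\<not> dist_le G n u v"
  obtains x where "dist_le G n u x" "x \<rightarrow>\<^bsub>G\<^esub> v"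
proof -
  obtain p where p: "awalk u p v" "length p \<le> Suc n"
    using assms(1) by (auto simp: dist_le_def)
  with assms(2) have "length p = Suc n"
    unfolding dist_le_def using le_SucE by blast
  then obtain q e where qe: "p = q @ [e]" "length q = n"
    by (metis length_Suc_conv_rev)
  with p have "awalk u q (tail G e)" "e \<in> arcs G" "head G e = v"
    by (auto simp: awalk_Cons_iff awalk_Nil_iff)
  then show thesis
    using that[of "tail G e"] qe unfolding dist_le_def
    by (metis in_arcs_imp_in_arcs_ends order_refl)
qed

end

context graph
begin

lemma dist_le_sym:
  assumes "dist_le G n u v" shows "dist_le G n v u"
  using assms
proof (induction n arbitrary: v)
  case 0
  then show ?case by (auto simp: dist_le_def awalk_Nil_iff)
next
  case (Suc n)
  show ?case
  proof (cases "dist_le G n u v")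
    case True
    then show ?thesis using Suc.IH dist_le_mono by (meson lessI less_imp_le)
  next
    case False
    then obtain x where "dist_le G n u x" "x \<rightarrow>\<^bsub>G\<^esub> v"
      using Suc.prems dist_le_SucD by blast
    then show ?thesis
      using Suc.IH dist_le_trans[OF dist_le_arc] graph_symmetric by fastforce
  qed
qed

end

locale rooted_connected_graph = graph +
  fixes r
  assumes connected: "connected G" and root: "r \<in> verts G"
begin

abbreviation "d \<equiv> depth G r"

lemma dist_le_depth: "v \<in> verts G \<Longrightarrow> dist_le G (d v) r v"
proof -
  assume "v \<in> verts G"
  then have "r \<rightarrow>\<^sup>*\<^bsub>mk_symmetric G\<^esub> v"
    using connected root by (auto simp: connected_def)
  \<comment> \<open>Connectedness speaks of the symmetric closure, whose reachability agrees with
    that of \<open>G\<close> because the arcs of \<open>G\<close> are already symmetric.\<close>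
  then obtain p where "awalk r p v"
    using reachable_mk_symmetric_eq[OF sym_arcs] reachable_awalk by blast
  then have "\<exists>n. dist_le G n r v" unfolding dist_le_def by blast
  then show ?thesis unfolding depth_def by (rule LeastI_ex)
qed

lemma depth_le: "dist_le G n r v \<Longrightarrow> d v \<le> n"
  unfolding depth_def by (rule Least_le)

lemma depth_arc_le:
  assumes "u \<rightarrow>\<^bsub>G\<^esub> v" shows "d v \<le> Suc (d u)"
  using depth_le[OF dist_le_trans[OF dist_le_depth dist_le_arc[OF assms]]] assms
  by (auto dest: adj_in_verts)

lemma depth_parent:
  assumes "v \<in> verts G" "d v = Suc n"
  obtains x where "x \<rightarrow>\<^bsub>G\<^esub> v" "d x = n"
proof -
  have "\<not> dist_le G n r v" using depth_le[of n v] assms(2) by auto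
  then obtain x where x: "dist_le G n r x" "x \<rightarrow>\<^bsub>G\<^esub> v"
    using dist_le_SucD dist_le_depth[OF assms(1)] assms(2) by metis
  \<comment> \<open>The walk gives \<open>d x \<le> n\<close>, and the arc into \<open>v\<close>
    forces \<open>d x \<ge> n\<close>.\<close>
  then show thesis using that depth_le depth_arc_le[OF x(2)] assms(2) by fastforce
qed

lemma depth_ancestor:
  assumes "v \<in> verts G" "k \<le> d v"
  shows "\<exists>x\<in>verts G. d x = d v - k \<and> dist_le G k v x"
  using assms(2)
proof (induction k)
  case 0
  then show ?case using assms(1) dist_le_refl by auto
next
  case (Suc k)
  then obtain x where x: "x \<in> verts G" "d x = d v - k" "dist_le G k v x" by auto
  moreover have "d x = Suc (d v - Suc k)" using x Suc.prems by simp
  ultimately obtain y where y: "y \<rightarrow>\<^bsub>G\<^esub> x" "d y = d v - Suc k" using depth_parent by metis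
  then have "dist_le G 1 x y" using dist_le_arc graph_symmetric by blast
  then show ?case using dist_le_trans[OF x(3)] y adj_in_verts(1) by fastforce
qed

text \<open>The depths of \<open>v\<close>, its parent and its grandparent are consecutive and so
  cover all residues. The bound 2 leaves one step for moving to a coloured vertex of the same
  layer.\<close>

lemma depth_ancestor_mod3:
  assumes "v \<in> verts G" "d v \<ge> 2" "j < 3"
  obtains x where "x \<in> verts G" "d x mod 3 = j" "dist_le G 2 v x"
proof -
  obtain k where k: "k \<le> 2" "(d v - k) mod 3 = j"
  proof -
    obtain n where n: "d v = n + 2" using assms(2) by (metis add.commute le_Suc_ex)
    have "n mod 3 < 3" by simp
    then consider "n mod 3 = 0" | "n mod 3 = 1" | "n mod 3 = 2" by linarith
    then have "(n + 2) mod 3 = j \<or> (n + 1) mod 3 = j \<or> n mod 3 = j"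
      using assms(3) by cases (simp_all add: mod_Suc, linarith+)
    then have "d v mod 3 = j \<or> (d v - 1) mod 3 = j \<or> (d v - 2) mod 3 = j"
      by (simp add: n)
    then show thesis using that[of 0] that[of 1] that[of 2] by auto
  qed
  then show thesis
    using depth_ancestor[OF assms(1), of k] assms(2) dist_le_mono that by fastforce
qed

lemma dominating_coloring:
  assumes "y \<in> verts G" "d y \<ge> 2"
  shows "\<exists>f. partial_coloring G {1, 2, 3} f \<and>
    (\<forall>v\<in>verts G. \<forall>i\<in>{1, 2, 3}. \<exists>w\<in>verts G. f w = Some i \<and> dist_le G 3 v w)"
proof -
  obtain I where I: "I \<subseteq> verts G"
    "\<And>u v. u \<in> I \<Longrightarrow> v \<in> I \<Longrightarrow> \<not> (u \<rightarrow>\<^bsub>G\<^esub> v \<and> d u = d v)"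
    "\<And>v. v \<in> verts G \<Longrightarrow> v \<in> I \<or> (\<exists>w\<in>I. v \<rightarrow>\<^bsub>G\<^esub> w \<and> d v = d w)"
    by (rule finite_maximal_independent[of "verts G" "\<lambda>u v. u \<rightarrow>\<^bsub>G\<^esub> v \<and> d u = d v"])
      (use graph_symmetric adj_not_same in auto)
  have near: "\<exists>w\<in>I. d w = d v \<and> dist_le G 1 v w" if "v \<in> verts G" for v
    using I(3)[OF that] dist_le_refl[OF that] dist_le_arc by metis
  \<comment> \<open>The shift by 1 turns the residues 0, 1, 2 into the colours 1, 2, 3.\<close>
  define f where "f v = (if v \<in> I then Some (d v mod 3 + 1) else None)" for v
  have coloring: "partial_coloring G {1, 2, 3} f"
    unfolding partial_coloring_def
  proof (intro conjI ballI impI)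
    show "dom f \<subseteq> verts G" using I(1) by (auto simp: f_def split: if_splits)
    show "ran f \<subseteq> {1, 2, 3}" by (auto simp: f_def ran_def split: if_splits)
    fix u v assume uv: "u \<in> dom f" "v \<in> dom f" "u \<rightarrow>\<^bsub>G\<^esub> v"
    then have in_I: "u \<in> I" "v \<in> I" by (auto simp: f_def split: if_splits)
    have "d v \<le> Suc (d u)" "d u \<le> Suc (d v)"
      using depth_arc_le[OF uv(3)] depth_arc_le[OF graph_symmetric[OF uv(3)]] .
    moreover have "d u \<noteq> d v" using I(2)[OF in_I] uv(3) by simp
    ultimately have "d v = Suc (d u) \<or> d u = Suc (d v)" by linarith
    then have "d u mod 3 \<noteq> d v mod 3" by (auto simp: mod_Suc split: if_splits)
    then show "f u \<noteq> f v" using in_I by (simp add: f_def)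
  qed
  have near_class: "\<exists>w\<in>I. d w mod 3 = j \<and> dist_le G 3 v w" if v: "v \<in> verts G" and j: "j < 3" for v j
  proof -
    \<comment> \<open>Two steps to \<open>x\<close> and one more to a vertex of \<open>I\<close> in
      the layer of \<open>x\<close> make three.\<close>
    have via: ?thesis if x: "x \<in> verts G" "d x mod 3 = j" "dist_le G 2 v x" for x
    proof -
      obtain w where w: "w \<in> I" "d w = d x" "dist_le G 1 x w" using near[OF x(1)] by blast
      then have "dist_le G 3 v w" using dist_le_trans[OF x(3) w(3)] by simp
      with w x(2) show ?thesis by metis
    qed
    \<comment> \<open>Climbing from \<open>y\<close> towards the root shows that layers 2 and 1 are
      nonempty.\<close>
    obtain z where z: "z \<in> verts G" "d z = 2"
      using depth_ancestor[OF assms(1), of "d y - 2"] assms(2) by auto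
    obtain c where c: "c \<in> verts G" "d c = 1"
      using depth_ancestor[OF z(1), of 1] z(2) by auto
    have r0: "d r = 0" using depth_le[OF dist_le_refl[OF root, of 0]] by simp
    have r_near: "dist_le G (d v) v r" using dist_le_sym[OF dist_le_depth[OF v]] .
    consider "d v \<ge> 2" | "d v = 0" | "d v = 1" by linarith
    then show ?thesis
    proof cases
      case 1
      then show ?thesis using depth_ancestor_mod3[OF v _ j] via by blast
    next
      case 2
      then have "v = r"
        using dist_le_depth[OF v] by (auto simp: dist_le_def awalk_Nil_iff)
      then have "dist_le G 2 v x" if "x \<in> verts G" "d x \<le> 2" for x
        using dist_le_mono[OF dist_le_depth[OF that(1)] that(2)] by simp
      then have ?thesis if "x \<in> verts G" "d x \<le> 2" "d x mod 3 = j" for x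
        using via[OF that(1,3)] that by blast
      moreover have "j = 0 \<or> j = 1 \<or> j = 2" using j by linarith
      ultimately show ?thesis using root c z r0 by fastforce
    next
      case 3
      \<comment> \<open>Going through the root to layer 2 already uses 1 + 2 steps, so
        \<open>via\<close> has no step to spare; the target is taken in \<open>I\<close> from the
        start.\<close>
      obtain w where w: "w \<in> I" "d w = 2" using near[OF z(1)] z(2) by metis
      have "d v + d w = 3" using w 3 by simp
      moreover have "w \<in> verts G" using w(1) I(1) by blast
      ultimately have "dist_le G 3 v w"
        using dist_le_trans[OF r_near dist_le_depth[of w]] by metis
      with w have ?thesis if "j = 2" using that by force
      moreover have ?thesis if "j = 0"
        using via[OF root] r0 that dist_le_mono[OF r_near] 3 by simp
      moreover have ?thesis if "j = 1"
        using via[OF v] 3 that dist_le_refl[OF v] by simp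
      ultimately show ?thesis using j by linarith
    qed
  qed
  have "\<exists>w\<in>verts G. f w = Some i \<and> dist_le G 3 v w"
    if v: "v \<in> verts G" and i: "i \<in> {1, 2, 3}" for v i
  proof -
    \<comment> \<open>Undoes the colour shift; the subtraction is exact since \<open>i\<close> is at
      least 1.\<close>
    obtain w where "w \<in> I" "d w mod 3 = i - 1" "dist_le G 3 v w"
      using near_class[OF v, of "i - 1"] i by auto
    with i I(1) show ?thesis by (intro bexI[of _ w]) (auto simp: f_def)
  qed
  with coloring show ?thesis by (intro exI[of _ f] conjI ballI)
qed

end

theorem theorem3:
  fixes G :: "('a, 'b) pre_digraph"
  assumes "graph G"
    and "Digraph_Component.connected G"
    and "card (verts G) \<ge> 3"
  shows "\<exists>f. partial_coloring G {1, 2, 3} f \<and>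
           (\<forall>v \<in> verts G. \<forall>i \<in> {1, 2, 3}. \<exists>w \<in> verts G. f w = Some i \<and> graph_dist G v w \<le> 3)"
proof -
  interpret graph G by fact
  have dist: "graph_dist G v w \<le> 3 \<longleftrightarrow> dist_le G 3 v w" for v w
    using graph_dist_le_iff[of v w 3] by (simp add: dist_le_def)
  show ?thesis
  proof (cases "\<exists>r\<in>verts G. \<exists>y\<in>verts G. \<not> dist_le G 1 r y")
    case True
    then obtain r y where ry: "r \<in> verts G" "y \<in> verts G" "\<not> dist_le G 1 r y" by blast
    interpret rooted_connected_graph G r
      by unfold_locales (use assms(2) ry(1) in auto)
    have "d y \<ge> 2"
      \<comment> \<open>Depth at most 1 would put \<open>y\<close> within distance 1 of
        \<open>r\<close>.\<close>
      using dist_le_mono[OF dist_le_depth[OF ry(2)], of 1] ry(3) by linarith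
    then show ?thesis using dominating_coloring[OF ry(2)] by (simp only: dist)
  next
    case False
    then have near: "dist_le G 3 u v" if "u \<in> verts G" "v \<in> verts G" for u v
      using that dist_le_mono[of 1 u v 3] by auto
    obtain S where "S \<subseteq> verts G" "card S = 3"
      using assms(3) by (meson obtain_subset_with_card_n)
    then obtain a b c where abc: "{a, b, c} \<subseteq> verts G" "a \<noteq> b" "a \<noteq> c" "b \<noteq> c"
      by (auto simp: card_3_iff)
    \<comment> \<open>All distances are now at most 1, so one vertex of each colour serves
      everybody; pairwise distinct colours are proper whatever the edges.\<close>
    define f where "f = [a \<mapsto> 1 :: nat, b \<mapsto> 2, c \<mapsto> 3]"
    have "partial_coloring G {1, 2, 3} f"
      using abc adj_not_same by (auto simp: partial_coloring_def f_def ran_def split: if_splits)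
    moreover have "\<exists>w\<in>verts G. f w = Some i" if "i \<in> {1, 2, 3}" for i
      using that abc by (auto simp: f_def)
    ultimately show ?thesis unfolding dist using near by (intro exI[of _ f]) metis
  qed
qed

end
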